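(* Let $n\ge1$. For any square-free polynomial $f\in\mathcal{H}_{n,d}$ and any integer $r\ge1$, one has $$\max_{x\in\Delta_n}\{B_r(f)(x)-f(x)\}\le\left(1-\frac{r^{\underline{d}}}{r^d}\right)(\overline{f}-\underline{f}).$$
   Context: $\mathbb{N}=\{0,1,2,\dots\}$. $\mathcal{H}_{n,d}$ is the set of homogeneous polynomials of degree $d$ in $n$ variables with real coefficients. A polynomial $f\in\mathcal{H}_{n,d}$ is square-free (multilinear) if it involves only monomials $x^I=\prod_{i\in I}x_i$ with $I\subseteq\{1,\dots,n\}$, i.e. $f=\sum_{I\subseteq\{1,\dots,n\},|I|=d}f_Ix^I$ with $f_I\in\mathbb{R}$. The standard simplex is $\Delta_n=\{x\in\mathbb{R}_+^n:\sum_{i=1}^n x_i=1\}$; $\underline{f}=\min_{x\in\Delta_n}f(x)$ and $\overline{f}=\max_{x\in\Delta_n}f(x)$. The falling factorial is $r^{\underline{d}}=r(r-1)\cdots(r-d+1)$ (so $r^{\underline{d}}=0$ if $r<d$). For $r\ge 0$, $I(n,r)=\{\alpha\in\mathbb{N}^n:\sum_{i=1}^n\alpha_i=r\}$. For $\alpha\in\mathbb{N}^n$, $\alpha!=\prod_{i=1}^n\alpha_i!$ and $x^\alpha=\prod_{i=1}^n x_i^{\alpha_i}$ (with $0^0=1$). The Bernstein approximation of order $r\ge1$ on the simplex of a polynomial $f$ is the polynomial $$B_r(f)(x)=\sum_{\alpha\in I(n,r)}f\left(\frac{\alpha}{r}\right)\frac{r!}{\alpha!}x^\alpha.$$ *)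

theory Defs
  imports "HOL-Analysis.Analysis" "HOL-Library.Poly_Mapping"
begin

text \<open>
  The variables are indexed by a finite type, so \<open>n = CARD('n)\<close>. A polynomial maps finitely
  many exponent vectors to nonzero real coefficients.
\<close>

type_synonym 'n rpoly = "(nat ^ 'n) \<Rightarrow>\<^sub>0 real"

definition monom_eval :: "real ^ 'n \<Rightarrow> nat ^ 'n \<Rightarrow> real"
  where "monom_eval x \<alpha> = (\<Prod>i\<in>UNIV. (x $ i) ^ (\<alpha> $ i))"

definition peval :: "'n::finite rpoly \<Rightarrow> real ^ 'n \<Rightarrow> real"
  where "peval f x = (\<Sum>\<alpha>\<in>Poly_Mapping.keys f. Poly_Mapping.lookup f \<alpha> * monom_eval x \<alpha>)"

definition exponents :: "nat \<Rightarrow> (nat ^ 'n) set"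
  where "exponents r = {\<alpha>. (\<Sum>i\<in>UNIV. \<alpha> $ i) = r}"

text \<open>As usual, the zero polynomial is homogeneous of every degree.\<close>

definition homogeneous_polys :: "nat \<Rightarrow> 'n::finite rpoly set"
  where "homogeneous_polys d = {f. Poly_Mapping.keys f \<subseteq> exponents d}"

definition subset_exponent :: "'n set \<Rightarrow> nat ^ 'n"
  where "subset_exponent I = (\<chi> i. if i \<in> I then 1 else 0)"

definition square_free_poly :: "'n::finite rpoly \<Rightarrow> bool"
  where "square_free_poly f \<longleftrightarrow> Poly_Mapping.keys f \<subseteq> range subset_exponent"

definition standard_simplex :: "(real ^ 'n) set"
  where "standard_simplex = {x. (\<forall>i. 0 \<le> x $ i) \<and> (\<Sum>i\<in>UNIV. x $ i) = 1}"

definition max_on :: "'a set \<Rightarrow> ('a \<Rightarrow> real) \<Rightarrow> real"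
  where "max_on S g = (GREATEST y. y \<in> g ` S)"

definition min_on :: "'a set \<Rightarrow> ('a \<Rightarrow> real) \<Rightarrow> real"
  where "min_on S g = (LEAST y. y \<in> g ` S)"

definition falling_factorial :: "nat \<Rightarrow> nat \<Rightarrow> real"
  where "falling_factorial r d = (\<Prod>j<d. real r - real j)"

definition multi_fact :: "nat ^ 'n \<Rightarrow> real"
  where "multi_fact \<alpha> = (\<Prod>i\<in>UNIV. fact (\<alpha> $ i))"

definition bernstein :: "nat \<Rightarrow> (real ^ 'n \<Rightarrow> real) \<Rightarrow> real ^ 'n \<Rightarrow> real"
  where "bernstein r g x =
    (\<Sum>\<alpha>\<in>exponents r. g (\<chi> i. real (\<alpha> $ i) / real r) * (fact r / multi_fact \<alpha>) * monom_eval x \<alpha>)"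

text \<open>
  The sums over \<^const>\<open>exponents\<close> are finite, and the maxima and minima over \<^const>\<open>standard_simplex\<close>
  of continuous functions exist, so no default values of sums or of \<^const>\<open>Greatest\<close> and
  \<^const>\<open>Least\<close> are involved.
\<close>

lemma finite_exponents: "finite (exponents r :: (nat ^ 'n) set)"
proof (rule finite_imageD)
  have "vec_nth ` (exponents r :: (nat ^ 'n) set) \<subseteq> (UNIV \<rightarrow>\<^sub>E {..r})"
  proof
    fix h assume "h \<in> vec_nth ` (exponents r :: (nat ^ 'n) set)"
    then obtain \<alpha> :: "nat ^ 'n" where h: "h = vec_nth \<alpha>" and r: "(\<Sum>i\<in>UNIV. \<alpha> $ i) = r"
      by (auto simp: exponents_def)
    have "\<alpha> $ i \<le> (\<Sum>i\<in>UNIV. \<alpha> $ i)" for i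
      by (rule member_le_sum) auto
    then show "h \<in> UNIV \<rightarrow>\<^sub>E {..r}"
      using h r by auto
  qed
  then show "finite (vec_nth ` (exponents r :: (nat ^ 'n) set))"
    by (rule finite_subset) (auto intro: finite_PiE)
  show "inj_on vec_nth (exponents r :: (nat ^ 'n) set)"
    by (auto simp: inj_on_def vec_eq_iff)
qed

lemma standard_simplex_nonempty: "(standard_simplex :: (real ^ 'n) set) \<noteq> {}"
proof -
  have "axis undefined 1 \<in> (standard_simplex :: (real ^ 'n) set)"
    by (auto simp: standard_simplex_def axis_def)
  then show ?thesis by blast
qed

lemma compact_standard_simplex: "compact (standard_simplex :: (real ^ 'n) set)"
proof -
  have "closed (standard_simplex :: (real ^ 'n) set)"
    unfolding standard_simplex_def
    by (intro closed_Collect_conj closed_Collect_all closed_Collect_le closed_Collect_eq continuous_intros)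
  moreover have "standard_simplex \<subseteq> cbox (0 :: real ^ 'n) (\<chi> i. 1)"
  proof
    fix x :: "real ^ 'n" assume x: "x \<in> standard_simplex"
    have "x $ i \<le> (\<Sum>i\<in>UNIV. x $ i)" for i
      by (rule member_le_sum) (use x in \<open>auto simp: standard_simplex_def\<close>)
    with x show "x \<in> cbox 0 (\<chi> i. 1)" by (auto simp: standard_simplex_def mem_box_cart)
  qed
  ultimately show ?thesis
    using bounded_cbox bounded_subset compact_eq_bounded_closed by blast
qed

lemma max_on_attained:
  assumes "compact S" "S \<noteq> {}" "continuous_on S g"
  shows "max_on S g \<in> g ` S" and "\<And>x. x \<in> S \<Longrightarrow> g x \<le> max_on S g"
proof -
  obtain z where z: "z \<in> S" "\<And>x. x \<in> S \<Longrightarrow> g x \<le> g z"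
    using continuous_attains_sup[OF assms] by blast
  then have "max_on S g = g z"
    unfolding max_on_def by (intro Greatest_equality) auto
  with z show "max_on S g \<in> g ` S" and "\<And>x. x \<in> S \<Longrightarrow> g x \<le> max_on S g" by auto
qed

lemma min_on_attained:
  assumes "compact S" "S \<noteq> {}" "continuous_on S g"
  shows "min_on S g \<in> g ` S" and "\<And>x. x \<in> S \<Longrightarrow> min_on S g \<le> g x"
proof -
  obtain z where z: "z \<in> S" "\<And>x. x \<in> S \<Longrightarrow> g z \<le> g x"
    using continuous_attains_inf[OF assms] by blast
  then have "min_on S g = g z"
    unfolding min_on_def by (intro Least_equality) auto
  with z show "min_on S g \<in> g ` S" and "\<And>x. x \<in> S \<Longrightarrow> min_on S g \<le> g x" by auto
qed

lemma continuous_on_peval: "continuous_on S (peval f)"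
  unfolding peval_def[abs_def] monom_eval_def by (intro continuous_intros)

lemma continuous_on_bernstein: "continuous_on S (bernstein r g)"
  unfolding bernstein_def[abs_def] monom_eval_def by (intro continuous_intros)

end

theory Submission
  imports Defs
begin

text \<open>
  For \<open>x\<close> in the simplex, \<open>bernstein r g x\<close> is the expected value of \<open>g (\<alpha> / r)\<close> when \<open>\<alpha>\<close> is
  multinomially distributed: it counts how often each variable \<open>i\<close> occurs in \<open>r\<close> independent
  draws with probabilities \<open>x $ i\<close>. The product of the counts \<open>\<alpha> $ i\<close> over a set \<open>I\<close> of \<open>d\<close>
  variables is the number of ways to choose distinct draws, one with each outcome in \<open>I\<close>. Its
  mean is therefore \<open>r(r - 1) \<dots> (r - d + 1)\<close> times the product of the \<open>x $ i\<close> over \<open>I\<close>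
  (\<open>multinomial_mean_prod\<close>). Consequently the Bernstein operator multiplies every square-free
  form of degree \<open>d\<close> by the constant \<open>c = r(r - 1) \<dots> (r - d + 1) / r\<^sup>d\<close>
  (\<open>bernstein_square_free\<close>), and the difference to be bounded equals \<open>- (1 - c) f(x)\<close>.

  Since \<open>c \<le> 1\<close>, this is at most \<open>- (1 - c)\<close> times the minimum of \<open>f\<close>, and it remains to see that
  \<open>(1 - c)\<close> times the maximum of \<open>f\<close> is nonnegative. If \<open>d \<ge> 2\<close>, then \<open>f\<close> vanishes at the
  vertices of the simplex, so that its maximum is nonnegative. If \<open>d \<le> 1\<close>, then \<open>c = 1\<close>.
\<close>

definition multinomial_mean :: "nat \<Rightarrow> real ^ 'n \<Rightarrow> (nat ^ 'n \<Rightarrow> real) \<Rightarrow> real"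
  where "multinomial_mean r x g =
    (\<Sum>\<alpha>\<in>exponents r. g \<alpha> * (fact r / multi_fact \<alpha>) * monom_eval x \<alpha>)"

lemma multi_fact_add_axis:
  "multi_fact (\<beta> + axis i 1) = real (Suc (\<beta> $ i)) * multi_fact (\<beta> :: nat ^ 'n)"
proof -
  have "multi_fact (\<beta> + axis i 1)
      = fact (Suc (\<beta> $ i)) * (\<Prod>j\<in>UNIV - {i}. fact ((\<beta> + axis i 1) $ j))"
    unfolding multi_fact_def by (subst prod.remove[of _ i]) (auto simp: axis_def)
  also have "(\<Prod>j\<in>UNIV - {i}. fact ((\<beta> + axis i 1) $ j)) = (\<Prod>j\<in>UNIV - {i}. fact (\<beta> $ j) :: real)"
    by (intro prod.cong) (auto simp: axis_def)
  also have "fact (Suc (\<beta> $ i)) * \<dots> = real (Suc (\<beta> $ i)) * multi_fact \<beta>"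
    unfolding multi_fact_def by (subst prod.remove[of UNIV i]) (auto simp: algebra_simps)
  finally show ?thesis .
qed

lemma monom_eval_add_axis:
  "monom_eval x (\<beta> + axis i 1) = x $ i * monom_eval x (\<beta> :: nat ^ 'n)"
proof -
  have "monom_eval x (\<beta> + axis i 1)
      = x $ i ^ Suc (\<beta> $ i) * (\<Prod>j\<in>UNIV - {i}. x $ j ^ ((\<beta> + axis i 1) $ j))"
    unfolding monom_eval_def by (subst prod.remove[of _ i]) (auto simp: axis_def)
  also have "(\<Prod>j\<in>UNIV - {i}. x $ j ^ ((\<beta> + axis i 1) $ j)) = (\<Prod>j\<in>UNIV - {i}. x $ j ^ (\<beta> $ j))"
    by (intro prod.cong) (auto simp: axis_def)
  also have "x $ i ^ Suc (\<beta> $ i) * \<dots> = x $ i * monom_eval x \<beta>"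
    unfolding monom_eval_def by (subst prod.remove[of UNIV i]) (auto simp: algebra_simps)
  finally show ?thesis .
qed

lemma add_axis_mem_exponents:
  "\<beta> + axis i 1 \<in> exponents (Suc r) \<longleftrightarrow> (\<beta> :: nat ^ 'n) \<in> exponents r"
  by (simp add: exponents_def axis_def sum.distrib)

lemma exponents_0: "exponents 0 = {0 :: nat ^ 'n}"
  by (auto simp: exponents_def vec_eq_iff)

text \<open>
  Weighting by \<open>\<alpha> $ i\<close> selects one of the \<open>r + 1\<close> draws and requires its outcome to be \<open>i\<close>;
  the other \<open>r\<close> draws are again multinomial. Everything about the means below comes from this
  recursion.
\<close>

lemma multinomial_mean_Suc:
  fixes x :: "real ^ 'n"
  shows "multinomial_mean (Suc r) x (\<lambda>\<alpha>. real (\<alpha> $ i) * g \<alpha>)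
    = real (Suc r) * x $ i * multinomial_mean r x (\<lambda>\<beta>. g (\<beta> + axis i 1))"
proof -
  let ?t = "\<lambda>\<alpha>. real (\<alpha> $ i) * g \<alpha> * (fact (Suc r) / multi_fact \<alpha>) * monom_eval x \<alpha>"
  let ?shift = "\<lambda>\<beta> :: nat ^ 'n. \<beta> + axis i 1"
  have image: "?shift ` exponents r = {\<alpha> \<in> exponents (Suc r). \<alpha> $ i \<noteq> 0}"
  proof (intro equalityI subsetI)
    fix \<alpha> assume "\<alpha> \<in> ?shift ` exponents r"
    then show "\<alpha> \<in> {\<alpha> \<in> exponents (Suc r). \<alpha> $ i \<noteq> 0}"
      by (auto simp: add_axis_mem_exponents simp del: One_nat_def)
  next
    fix \<alpha> :: "nat ^ 'n" assume \<alpha>: "\<alpha> \<in> {\<alpha> \<in> exponents (Suc r). \<alpha> $ i \<noteq> 0}"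
    define \<beta> where "\<beta> = \<alpha> - axis i 1"
    have "\<alpha> = ?shift \<beta>"
      using \<alpha> by (auto simp: \<beta>_def vec_eq_iff axis_def)
    with \<alpha> show "\<alpha> \<in> ?shift ` exponents r"
      by (auto simp: add_axis_mem_exponents simp del: One_nat_def)
  qed
  have "(\<Sum>\<alpha>\<in>exponents (Suc r). ?t \<alpha>) = (\<Sum>\<alpha>\<in>?shift ` exponents r. ?t \<alpha>)"
    unfolding image by (rule sum.mono_neutral_right) (auto simp: finite_exponents)
  also have "\<dots> = (\<Sum>\<beta>\<in>exponents r. ?t (?shift \<beta>))"
    by (subst sum.reindex) (auto simp: inj_on_def)
  also have "\<dots> = (\<Sum>\<beta>\<in>exponents r. real (Suc r) * x $ i *
      (g (?shift \<beta>) * (fact r / multi_fact \<beta>) * monom_eval x \<beta>))"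
  proof (rule sum.cong[OF refl])
    fix \<beta> :: "nat ^ 'n"
    have "multi_fact \<beta> \<noteq> 0" by (simp add: multi_fact_def)
    moreover have "?shift \<beta> $ i = Suc (\<beta> $ i)" by simp
    ultimately show "?t (?shift \<beta>) = real (Suc r) * x $ i *
      (g (?shift \<beta>) * (fact r / multi_fact \<beta>) * monom_eval x \<beta>)"
      unfolding multi_fact_add_axis monom_eval_add_axis fact_Suc
      by (simp add: divide_simps del: of_nat_Suc)
  qed
  finally show ?thesis
    by (simp add: multinomial_mean_def sum_distrib_left)
qed

text \<open>
  The multinomial theorem for \<open>(\<Sum>i. x $ i) ^ r\<close>. Since the counts of \<open>r + 1\<close> draws add up to
  \<open>r + 1\<close>, summing the recursion over all variables gives the induction step.
\<close>

lemma multinomial_mean_1: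
  fixes x :: "real ^ 'n"
  assumes "(\<Sum>i\<in>UNIV. x $ i) = 1"
  shows "multinomial_mean r x (\<lambda>_. 1) = 1"
proof (induction r)
  case 0
  show ?case
    by (simp add: multinomial_mean_def exponents_0 multi_fact_def monom_eval_def)
next
  case (Suc r)
  have "real (Suc r) * multinomial_mean (Suc r) x (\<lambda>_. 1)
      = multinomial_mean (Suc r) x (\<lambda>\<alpha>. \<Sum>i\<in>UNIV. real (\<alpha> $ i) * 1)"
    unfolding multinomial_mean_def sum_distrib_left
    by (rule sum.cong) (auto simp: exponents_def simp flip: of_nat_sum)
  also have "\<dots> = (\<Sum>i\<in>UNIV. multinomial_mean (Suc r) x (\<lambda>\<alpha>. real (\<alpha> $ i) * 1))"
    unfolding multinomial_mean_def sum_distrib_right by (rule sum.swap)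
  also have "\<dots> = real (Suc r)"
    unfolding multinomial_mean_Suc Suc.IH using assms
    by (simp del: of_nat_Suc flip: sum_distrib_left)
  finally show ?case by simp
qed

lemma falling_factorial_Suc_Suc:
  "falling_factorial (Suc r) (Suc d) = real (Suc r) * falling_factorial r d"
  unfolding falling_factorial_def by (subst prod.lessThan_Suc_shift) simp

text \<open>
  The recursion removes the variables of \<open>I\<close> one at a time. The variables of \<open>I\<close> are distinct, so
  removing a draw with outcome \<open>i\<close> leaves the other counts in the product unchanged.
\<close>

lemma multinomial_mean_prod:
  fixes x :: "real ^ 'n"
  assumes sum_1: "(\<Sum>i\<in>UNIV. x $ i) = 1" and "finite I"
  shows "multinomial_mean r x (\<lambda>\<alpha>. \<Prod>i\<in>I. real (\<alpha> $ i))
    = falling_factorial r (card I) * (\<Prod>i\<in>I. x $ i)"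
  using \<open>finite I\<close>
proof (induction I arbitrary: r rule: finite_induct)
  case empty
  then show ?case by (simp add: multinomial_mean_1[OF sum_1] falling_factorial_def)
next
  case (insert i I)
  show ?case
  proof (cases r)
    case 0
    with insert.hyps show ?thesis
      by (simp add: multinomial_mean_def exponents_0 falling_factorial_def
          prod.lessThan_Suc_shift del: prod.lessThan_Suc)
  next
    case (Suc m)
    have other_counts: "(\<Prod>j\<in>I. real ((\<beta> + axis i 1) $ j)) = (\<Prod>j\<in>I. real (\<beta> $ j))" for \<beta> :: "nat ^ 'n"
      using insert.hyps by (intro prod.cong) (auto simp: axis_def)
    show ?thesis
      using insert.hyps
      by (simp add: Suc multinomial_mean_Suc other_counts insert.IH falling_factorial_Suc_Suc
          del: of_nat_Suc vector_add_component One_nat_def)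
  qed
qed

lemma monom_eval_subset_exponent: "monom_eval x (subset_exponent I) = (\<Prod>i\<in>I. x $ i)"
proof -
  have "monom_eval x (subset_exponent I) = (\<Prod>i\<in>UNIV. if i \<in> I then x $ i else 1)"
    unfolding monom_eval_def by (intro prod.cong) (auto simp: subset_exponent_def)
  then show ?thesis by (simp flip: prod.inter_restrict)
qed

lemma subset_exponent_mem_exponents: "subset_exponent I \<in> exponents d \<longleftrightarrow> card I = d"
  by (simp add: exponents_def subset_exponent_def flip: sum.inter_filter)

lemma square_free_homogeneous_key:
  assumes "f \<in> homogeneous_polys d" "square_free_poly f" "\<gamma> \<in> Poly_Mapping.keys f"
  obtains I where "\<gamma> = subset_exponent I" "card I = d"
  using assms that
  unfolding homogeneous_polys_def square_free_poly_def
  by (force simp: subset_exponent_mem_exponents)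

text \<open>
  By homogeneity, replacing \<open>\<alpha>\<close> by \<open>\<alpha> / r\<close> divides the mean of each monomial by \<open>r ^ d\<close>. The
  resulting factor depends only on \<open>r\<close> and \<open>d\<close>, hence is common to all monomials of \<open>f\<close>.
\<close>

lemma bernstein_square_free:
  fixes f :: "'n::finite rpoly"
  assumes f: "f \<in> homogeneous_polys d" "square_free_poly f"
    and sum_1: "(\<Sum>i\<in>UNIV. x $ i) = 1"
  shows "bernstein r (peval f) x = falling_factorial r d / real r ^ d * peval f x"
proof -
  have monomial: "multinomial_mean r x (\<lambda>\<alpha>. monom_eval (\<chi> i. real (\<alpha> $ i) / real r) \<gamma>)
      = falling_factorial r d / real r ^ d * monom_eval x \<gamma>"
    if key: "\<gamma> \<in> Poly_Mapping.keys f" for \<gamma>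
  proof -
    obtain I where \<gamma>: "\<gamma> = subset_exponent I" and d: "card I = d"
      using square_free_homogeneous_key[OF f key] .
    have "multinomial_mean r x (\<lambda>\<alpha>. monom_eval (\<chi> i. real (\<alpha> $ i) / real r) \<gamma>)
        = multinomial_mean r x (\<lambda>\<alpha>. \<Prod>i\<in>I. real (\<alpha> $ i)) / real r ^ d"
      unfolding \<gamma> multinomial_mean_def monom_eval_subset_exponent sum_divide_distrib
      by (simp add: prod_dividef d mult.commute)
    then show ?thesis
      by (simp add: multinomial_mean_prod[OF sum_1] \<gamma> d monom_eval_subset_exponent)
  qed
  have "bernstein r (peval f) x = (\<Sum>\<gamma>\<in>Poly_Mapping.keys f. Poly_Mapping.lookup f \<gamma> *
      multinomial_mean r x (\<lambda>\<alpha>. monom_eval (\<chi> i. real (\<alpha> $ i) / real r) \<gamma>))"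
    unfolding bernstein_def peval_def multinomial_mean_def sum_distrib_right sum_distrib_left
    by (subst sum.swap) (simp add: mult.assoc)
  also have "\<dots> = falling_factorial r d / real r ^ d * peval f x"
    unfolding peval_def sum_distrib_left by (intro sum.cong refl) (simp add: monomial)
  finally show ?thesis .
qed

text \<open>
  Only one coordinate of a vertex is nonzero, whereas each monomial is a product of at least two
  distinct coordinates.
\<close>

lemma square_free_peval_vertex:
  fixes f :: "'n::finite rpoly"
  assumes f: "f \<in> homogeneous_polys d" "square_free_poly f" and d: "d \<ge> 2"
  shows "peval f (axis k 1) = 0"
  unfolding peval_def
proof (intro sum.neutral ballI)
  fix \<gamma> assume "\<gamma> \<in> Poly_Mapping.keys f"
  then obtain I where \<gamma>: "\<gamma> = subset_exponent I" and I: "card I = d"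
    using square_free_homogeneous_key[OF f] by blast
  have "\<not> I \<subseteq> {k}"
    using d I card_mono[of "{k}" I] by auto
  then obtain j where "j \<in> I" "j \<noteq> k" by blast
  then have "(\<Prod>i\<in>I. (axis k 1 :: real ^ 'n) $ i) = 0"
    by (intro prod_zero) (auto simp: axis_def)
  then show "Poly_Mapping.lookup f \<gamma> * monom_eval (axis k 1) \<gamma> = 0"
    by (simp add: \<gamma> monom_eval_subset_exponent)
qed

lemma falling_factorial_le_power: "falling_factorial r d \<le> real r ^ d"
proof (cases "d \<le> r")
  case True
  then have "(\<Prod>j<d. real r - real j) \<le> (\<Prod>j<d. real r)"
    by (intro prod_mono) auto
  then show ?thesis by (simp add: falling_factorial_def)
next
  case False
  \<comment> \<open>The factor with index \<open>r\<close> is zero.\<close>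
  then have "falling_factorial r d = 0"
    unfolding falling_factorial_def by (intro prod_zero) auto
  then show ?thesis by simp
qed

theorem theorem6:
  fixes f :: "'n::finite rpoly" and d r :: nat
  assumes "f \<in> homogeneous_polys d"
    and "square_free_poly f"
    and "r \<ge> 1"
  shows "max_on standard_simplex (\<lambda>x. bernstein r (peval f) x - peval f x)
    \<le> (1 - falling_factorial r d / real r ^ d) *
      (max_on standard_simplex (peval f) - min_on standard_simplex (peval f))"
proof -
  define c where "c = falling_factorial r d / real r ^ d"
  let ?max = "max_on standard_simplex (peval f)"
  let ?min = "min_on standard_simplex (peval f)"
  note attained = compact_standard_simplex standard_simplex_nonempty
  have c_le_1: "c \<le> 1"
    using falling_factorial_le_power[of r d] \<open>r \<ge> 1\<close> by (simp add: c_def divide_le_eq_1)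
  have max_part: "0 \<le> (1 - c) * ?max"
  proof (cases "d \<ge> 2")
    case True
    have "axis undefined 1 \<in> (standard_simplex :: (real ^ 'n) set)"
      by (auto simp: standard_simplex_def axis_def)
    then have "peval f (axis undefined 1) \<le> ?max"
      by (rule max_on_attained(2)[OF attained continuous_on_peval])
    then show ?thesis
      using c_le_1 by (simp add: square_free_peval_vertex[OF assms(1,2) True])
  next
    case False
    then have "d = 0 \<or> d = 1" by auto
    then have "c = 1" using \<open>r \<ge> 1\<close> by (auto simp: c_def falling_factorial_def)
    then show ?thesis by simp
  qed
  have "max_on standard_simplex (\<lambda>x. bernstein r (peval f) x - peval f x)
      \<in> (\<lambda>x. bernstein r (peval f) x - peval f x) ` standard_simplex"
    by (intro max_on_attained(1) attained continuous_on_diff continuous_on_bernstein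
        continuous_on_peval)
  then obtain x where x: "x \<in> standard_simplex"
    and max_eq: "max_on standard_simplex (\<lambda>x. bernstein r (peval f) x - peval f x)
      = bernstein r (peval f) x - peval f x"
    by blast
  have "bernstein r (peval f) x = c * peval f x"
    unfolding c_def using x
    by (intro bernstein_square_free assms) (simp add: standard_simplex_def)
  then have "bernstein r (peval f) x - peval f x = - ((1 - c) * peval f x)"
    by (simp add: algebra_simps)
  also have "\<dots> \<le> - ((1 - c) * ?min)"
    using min_on_attained(2)[OF attained continuous_on_peval x] c_le_1
    by (simp add: mult_left_mono)
  also have "\<dots> \<le> (1 - c) * (?max - ?min)"
    using max_part by (simp add: right_diff_distrib)
  finally show ?thesis
    unfolding max_eq c_def .
qed

end
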